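(* Let $Y$ be a finite undirected graph with vertex set $\{1,\dots,n\}$, let $K$ be a finite set, and let $\mathfrak{F}_Y=(F_i)_{i=1}^n$ be any sequence of $Y$-local functions $F_i\colon K^n\to K^n$. Then for every word $w=(w_1,\dots,w_m)$ over the vertex set of $Y$ and every integer $s$, the SDS maps $[\mathfrak{F}_Y,w]$ and $[\mathfrak{F}_Y,\boldsymbol{\sigma}_s(w)]$ are cycle equivalent, where $\boldsymbol{\sigma}_s(w)$ is the $s$-fold cyclic shift of $w$.
   Context: Graphs are finite, simple and undirected. Each vertex $v$ has a state $y_v\in K$; $\mathbf{y}=(y_1,\dots,y_n)\in K^n$ is a system state, and $\mathbf{y}[i]$ denotes the restriction of $\mathbf{y}$ to the vertex $i$ together with its neighbors in $Y$ (ordered increasingly). A $Y$-local function at $i$ is a map $F_i\colon K^n\to K^n$ of the form $F_i(y_1,\dots,y_n)=(y_1,\dots,y_{i-1},f_i(\mathbf{y}[i]),y_{i+1},\dots,y_n)$, where $f_i\colon K^{d(i)+1}\to K$ is an arbitrary function (the vertex function) and $d(i)$ is the degree of $i$. For a word $w=(w_1,\dots,w_m)$ over the vertex set (vertices may repeat or be absent) the SDS map is $[\mathfrak{F}_Y,w]=F_{w_m}\circ F_{w_{m-1}}\circ\cdots\circ F_{w_1}$. The shift is $\boldsymbol{\sigma}_1(w)=(w_2,w_3,\dots,w_m,w_1)$, and $\boldsymbol{\sigma}_s$ is the $s$-th iterate of $\boldsymbol{\sigma}_1$. For a map $\phi$ of a finite set to itself, $\mathrm{Per}(\phi)$ is its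 set of periodic points. Two self-maps $\phi,\psi$ of finite sets are cycle equivalent if there is a bijection $h\colon \mathrm{Per}(\phi)\to\mathrm{Per}(\psi)$ with $\psi|_{\mathrm{Per}(\psi)}\circ h=h\circ\phi|_{\mathrm{Per}(\phi)}$. *)

theory Defs
  imports "Graph_Theory.Pair_Digraph" "HOL-Library.FuncSet"
begin

text \<open>
  A simple undirected graph is a \<^const>\<open>pair_graph\<close>: finite, without loops, and each edge
  represented by its two opposite arcs. System states of a graph \<open>Y\<close> are functions on its vertices
  with values in \<open>K\<close>, extended by \<^const>\<open>undefined\<close> outside the vertex set; for vertex set
  \<open>{1..n}\<close> this is \<open>K\<close> to the power \<open>n\<close>.
\<close>

definition states :: "nat pair_pre_digraph \<Rightarrow> 'k set \<Rightarrow> (nat \<Rightarrow> 'k) set" where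
  "states Y K = pverts Y \<rightarrow>\<^sub>E K"

definition neighbors :: "nat pair_pre_digraph \<Rightarrow> nat \<Rightarrow> nat set" where
  "neighbors Y i = {j. (i, j) \<in> parcs Y}"

definition local_state :: "nat pair_pre_digraph \<Rightarrow> (nat \<Rightarrow> 'k) \<Rightarrow> nat \<Rightarrow> 'k list" where
  "local_state Y y i = map y (sorted_list_of_set (insert i (neighbors Y i)))"

text \<open>
  As both arcs of an edge are present, the out-degree is the undirected degree. Functions \<open>F\<close> and
  \<open>f\<close> matter only on states and on lists of the right length over \<open>K\<close>, respectively.
\<close>

definition local_function ::
  "nat pair_pre_digraph \<Rightarrow> 'k set \<Rightarrow> nat \<Rightarrow> ((nat \<Rightarrow> 'k) \<Rightarrow> (nat \<Rightarrow> 'k)) \<Rightarrow> bool" where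
  "local_function Y K i F \<longleftrightarrow>
     (\<exists>f \<in> {xs. set xs \<subseteq> K \<and> length xs = out_degree (with_proj Y) i + 1} \<rightarrow> K.
        \<forall>y \<in> states Y K. F y = y(i := f (local_state Y y i)))"

text \<open>The first letter of the word acts first.\<close>

definition sds_map :: "(nat \<Rightarrow> (nat \<Rightarrow> 'k) \<Rightarrow> (nat \<Rightarrow> 'k)) \<Rightarrow> nat list \<Rightarrow> (nat \<Rightarrow> 'k) \<Rightarrow> (nat \<Rightarrow> 'k)" where
  "sds_map F w = fold F w"

text \<open>The one-step shift \<^const>\<open>rotate1\<close> is a bijection, so that it has iterates of negative order.\<close>

definition cyclic_shift :: "int \<Rightarrow> 'a list \<Rightarrow> 'a list" where
  "cyclic_shift s = (if s \<ge> 0 then rotate1 ^^ nat s else inv rotate1 ^^ nat (- s))"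

definition periodic_points :: "'a set \<Rightarrow> ('a \<Rightarrow> 'a) \<Rightarrow> 'a set" where
  "periodic_points X \<phi> = {x \<in> X. \<exists>k>0. (\<phi> ^^ k) x = x}"

text \<open>For self-maps \<open>\<phi>\<close> of \<open>X\<close> and \<open>\<psi>\<close> of \<open>Z\<close>; the carriers are explicit because functions are total on
  their types.\<close>

definition cycle_equivalent :: "'a set \<Rightarrow> ('a \<Rightarrow> 'a) \<Rightarrow> 'b set \<Rightarrow> ('b \<Rightarrow> 'b) \<Rightarrow> bool" where
  "cycle_equivalent X \<phi> Z \<psi> \<longleftrightarrow>
     (\<exists>h. bij_betw h (periodic_points X \<phi>) (periodic_points Z \<psi>) \<and>
          (\<forall>x \<in> periodic_points X \<phi>. \<psi> (h x) = h (\<phi> x)))"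

end

theory Submission
  imports Defs
begin

text \<open>
  A cyclic shift turns a word \<open>u @ v\<close> into \<open>v @ u\<close>, hence a composition \<open>B \<circ> A\<close> into \<open>A \<circ> B\<close>.
  As \<open>A \<circ> (B \<circ> A) = (A \<circ> B) \<circ> A\<close>, the map \<open>A\<close> carries periodic points of \<open>B \<circ> A\<close> to those of
  \<open>A \<circ> B\<close> and conjugates the two actions. It is a bijection there: it is injective because \<open>B \<circ> A\<close>
  is, and a point \<open>z\<close> of period \<open>k\<close> has the preimage \<open>B ((A \<circ> B)\<^sup>k\<^sup>-\<^sup>1 z)\<close>.
\<close>

lemma funpow_comp_commute: "((A \<circ> B) ^^ k) (A x) = A (((B \<circ> A) ^^ k) x)"
  by (induction k) simp_all

lemma funpow_in_invariant_set:
  assumes "\<phi> \<in> X \<rightarrow> X" and "x \<in> X"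
  shows "(\<phi> ^^ k) x \<in> X"
  using assms by (induction k) auto

text \<open>Points of periods \<open>k\<close> and \<open>l\<close> are both fixed by the iterate of
  order \<open>k * l\<close>. As \<open>k * l\<close> is positive, this iterate applies
  \<open>\<phi>\<close> first, so its value depends only on the image under
  \<open>\<phi>\<close>.\<close>

lemma inj_on_periodic_points: "inj_on \<phi> (periodic_points X \<phi>)"
proof (rule inj_onI)
  fix x y
  assume "x \<in> periodic_points X \<phi>" and "y \<in> periodic_points X \<phi>" and eq: "\<phi> x = \<phi> y"
  then obtain k l where k: "k > 0" "(\<phi> ^^ k) x = x" and l: "l > 0" "(\<phi> ^^ l) y = y"
    by (auto simp: periodic_points_def)
  have x: "(\<phi> ^^ (k * l)) x = x"
    using funpow_mod_eq[OF k(2), of "k * l"] by simp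
  have y: "(\<phi> ^^ (k * l)) y = y"
    using funpow_mod_eq[OF l(2), of "k * l"] by simp
  obtain m where m: "k * l = Suc m"
    using k(1) l(1) by (metis gr0_implies_Suc nat_0_less_mult_iff)
  show "x = y"
    using x y eq unfolding m by (simp add: funpow_swap1)
qed

lemma periodic_points_comp_commute:
  assumes "A \<in> X \<rightarrow> Z" and "x \<in> periodic_points X (B \<circ> A)"
  shows "A x \<in> periodic_points Z (A \<circ> B)"
  using assms by (force simp: periodic_points_def funpow_comp_commute)

lemma cycle_equivalent_comp_commute:
  assumes A: "A \<in> X \<rightarrow> Z" and B: "B \<in> Z \<rightarrow> X"
  shows "cycle_equivalent X (B \<circ> A) Z (A \<circ> B)"
  unfolding cycle_equivalent_def
proof (intro exI conjI ballI)
  show "bij_betw A (periodic_points X (B \<circ> A)) (periodic_points Z (A \<circ> B))"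
    unfolding bij_betw_def
  proof (intro conjI equalityI)
    show "inj_on A (periodic_points X (B \<circ> A))"
      using inj_on_periodic_points by (rule inj_on_imageI2)
    show "A ` periodic_points X (B \<circ> A) \<subseteq> periodic_points Z (A \<circ> B)"
      using periodic_points_comp_commute[OF A] by blast
    show "periodic_points Z (A \<circ> B) \<subseteq> A ` periodic_points X (B \<circ> A)"
    proof
      fix z
      assume z: "z \<in> periodic_points Z (A \<circ> B)"
      then obtain m where m: "((A \<circ> B) ^^ Suc m) z = z" and zZ: "z \<in> Z"
        by (auto simp: periodic_points_def dest!: gr0_implies_Suc)
      \<comment> \<open>\<open>m\<close> is one less than a period of \<open>z\<close>, so
        \<open>z'\<close> is the predecessor of \<open>z\<close> on its cycle. Being periodic
        itself, it is a legitimate input for \<open>periodic_points_comp_commute\<close> with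
        \<open>A\<close> and \<open>B\<close> exchanged.\<close>
      define z' where "z' = ((A \<circ> B) ^^ m) z"
      have "z' \<in> Z"
        unfolding z'_def using A B zZ by (intro funpow_in_invariant_set) auto
      moreover have "((A \<circ> B) ^^ Suc m) z' = z'"
        unfolding z'_def using m by (metis add.commute comp_apply funpow_add)
      ultimately have "z' \<in> periodic_points Z (A \<circ> B)"
        unfolding periodic_points_def by blast
      then have "B z' \<in> periodic_points X (B \<circ> A)"
        by (rule periodic_points_comp_commute[OF B])
      moreover have "A (B z') = z"
        using m by (simp add: z'_def)
      ultimately show "z \<in> A ` periodic_points X (B \<circ> A)"
        by force
    qed
  qed
qed simp

text \<open>Rotating a list as often as it has entries restores it. For the empty list the truncated
  subtraction gives 0, which is harmless.\<close>

lemma inv_rotate1: "inv rotate1 xs = rotate (length xs - 1) xs"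
proof -
  have "rotate1 (rotate (length xs - 1) xs) = xs"
    by (cases xs) (simp_all flip: rotate_Suc)
  then show ?thesis
    by (metis inv_f_f inj_rotate1)
qed

text \<open>Reduces shifts of negative order to forward rotations; \<open>k\<close> may depend on
  the length of \<open>w\<close>, which rotations preserve.\<close>

lemma cyclic_shift_eq_rotate: "\<exists>k. cyclic_shift s w = rotate k w"
proof -
  have "\<exists>k. (inv rotate1 ^^ m) w = rotate k w" for m
  proof (induction m)
    case 0
    show ?case by (rule exI[of _ 0]) simp
  next
    case (Suc m)
    then show ?case by (auto simp: inv_rotate1 rotate_rotate)
  qed
  then show ?thesis
    by (auto simp: cyclic_shift_def rotate_def)
qed

lemma length_local_state:
  assumes "pair_graph Y"
  shows "length (local_state Y y i) = out_degree (with_proj Y) i + 1"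
proof -
  interpret pair_graph Y by fact
  \<comment> \<open>Arcs leaving \<open>i\<close> correspond to their heads, so counting neighbors
    gives the out-degree; the extra 1 is \<open>i\<close> itself, which has no loop.\<close>
  have arcs: "out_arcs (with_proj Y) i = Pair i ` neighbors Y i"
    by (auto simp: out_arcs_def neighbors_def)
  have "finite (neighbors Y i)"
    using finite_out_arcs[of i] unfolding arcs by (rule finite_imageD) (simp add: inj_on_def)
  moreover have "i \<notin> neighbors Y i"
    using no_loops by (force simp: neighbors_def)
  ultimately show ?thesis
    by (simp add: local_state_def out_degree_def arcs card_image inj_on_def)
qed

lemma set_local_state:
  assumes "pair_graph Y" and "i \<in> pverts Y" and "y \<in> states Y K"
  shows "set (local_state Y y i) \<subseteq> K"
proof -
  interpret pair_graph Y by fact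
  have sub: "insert i (neighbors Y i) \<subseteq> pverts Y"
    using assms(2) in_arcsD2 by (auto simp: neighbors_def)
  then have "finite (insert i (neighbors Y i))"
    by (rule finite_subset) simp
  then have "set (local_state Y y i) = y ` insert i (neighbors Y i)"
    by (simp add: local_state_def del: sorted_list_of_set.sorted_key_list_of_set_insert_remove)
  then show ?thesis
    using sub assms(3) by (auto simp: states_def PiE_iff)
qed

text \<open>The vertex function is known to land in \<open>K\<close> only on lists over
  \<open>K\<close> of length degree plus one, hence the two preceding lemmas. Updating at a vertex
  leaves the value \<open>undefined\<close> elsewhere intact.\<close>

lemma local_function_in_states:
  assumes "pair_graph Y" and i: "i \<in> pverts Y" and "local_function Y K i G"
  shows "G \<in> states Y K \<rightarrow> states Y K"
proof
  fix y
  assume y: "y \<in> states Y K"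
  obtain f where f: "f \<in> {xs. set xs \<subseteq> K \<and> length xs = out_degree (with_proj Y) i + 1} \<rightarrow> K"
    and G: "G y = y(i := f (local_state Y y i))"
    using assms(3) y by (auto simp: local_function_def)
  have "f (local_state Y y i) \<in> K"
    using f length_local_state[OF assms(1)] set_local_state[OF assms(1) i y] by auto
  with y i show "G y \<in> states Y K"
    unfolding G states_def by (auto simp: PiE_iff extensional_def)
qed

lemma sds_map_in_invariant_set:
  assumes "\<And>i. i \<in> set w \<Longrightarrow> F i \<in> X \<rightarrow> X"
  shows "sds_map F w \<in> X \<rightarrow> X"
  using assms by (induction w) (fastforce simp: sds_map_def)+

theorem theorem3p3:
  fixes Y :: "nat pair_pre_digraph" and n :: nat and K :: "'k set"
    and F :: "nat \<Rightarrow> (nat \<Rightarrow> 'k) \<Rightarrow> (nat \<Rightarrow> 'k)"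
    and w :: "nat list" and s :: int
  assumes "pair_graph Y" and "pverts Y = {1..n}"
    and "finite K"
    and "\<And>i. i \<in> {1..n} \<Longrightarrow> local_function Y K i (F i)"
    and "set w \<subseteq> {1..n}"
  shows "cycle_equivalent (states Y K) (sds_map F w)
           (states Y K) (sds_map F (cyclic_shift s w))"
proof -
  obtain k where "cyclic_shift s w = rotate k w"
    using cyclic_shift_eq_rotate by blast
  \<comment> \<open>\<open>u\<close> is the prefix of \<open>w\<close> of length
    \<open>k mod length w\<close>.\<close>
  then obtain u v where w: "w = u @ v" and shift: "cyclic_shift s w = v @ u"
    by (metis append_take_drop_id rotate_drop_take)
  have "F i \<in> states Y K \<rightarrow> states Y K" if "i \<in> set w" for i
    using that assms by (intro local_function_in_states[of Y i]) auto
  then have "sds_map F u \<in> states Y K \<rightarrow> states Y K" "sds_map F v \<in> states Y K \<rightarrow> states Y K"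
    by (auto intro!: sds_map_in_invariant_set simp: w)
  then have "cycle_equivalent (states Y K) (sds_map F v \<circ> sds_map F u)
               (states Y K) (sds_map F u \<circ> sds_map F v)"
    by (rule cycle_equivalent_comp_commute)
  \<comment> \<open>Since the first letter acts first, \<open>fold\<close> turns
    \<open>u @ v\<close> into the map of \<open>v\<close> after the map of \<open>u\<close>.\<close>
  then show ?thesis
    unfolding shift by (simp add: w sds_map_def)
qed

end
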